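(* Let $\mathcal F=\{f_n\}_{n\ge1}$ be a martingale difference, and let $$p_n(x)=\sum_{j\in G_n}c_jf_j(x),\qquad n=1,2,\ldots,$$ be a system of $L^2$-normalized ($\|p_n\|_2=1$) non-overlapping $\mathcal F$-polynomials, where the sets $G_n\subset\mathbb N$ are finite and pairwise disjoint and $c_j\in\mathbb R$. Then $\log n$ is a C-multiplier for $\{p_n\}$; that is, for all real coefficients $a_n$ with $\sum_{n=1}^\infty a_n^2\log n<\infty$, the series $\sum_{n=1}^\infty a_np_n(x)$ converges almost everywhere on $[0,1)$.
   Context: Functions are real-valued, on $[0,1)$ with Lebesgue measure; $\log$ has base $2$. A partition of $[0,1)$ is a (finite or infinite) sequence of pairwise disjoint measurable sets with union $[0,1)$. A filtration is a sequence $\mathcal A_n$, $n=1,2,\ldots$, of partitions of $[0,1)$ such that every $A\in\mathcal A_n$ is a union of some sets from $\mathcal A_{n+1}$ (called children of $A$). A martingale difference based on a filtration $\{\mathcal A_n\}$ is a sequence of functions $f_n\in L^1(0,1)$, $n=1,2,\ldots$, such that (1) $f_n$ is constant on each $A\in\mathcal A_n$; (2) $\int_A f_n=0$ for every $A\in\mathcal A_{n-1}$, $n\ge2$. A martingale difference is such a sequence for some filtration. A sequence $\omega(n)\nearrow\infty$ is an a.e. convergence Weyl multiplier (C-multiplier) for an orthonormal system $\{\phi_n\}$ if every series $\sum_{n=1}^\infty a_n\phi_n(x)$ with $\sum_{n=1}^\infty a_n^2\,\omega(n)<\infty$ converges a.e. (The value $\log1=0$ at $n=1$ is immaterial for this.)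 *)

theory Defs
  imports "HOL-Analysis.Analysis"
begin

text \<open>
  All sequences of the source are indexed from 1. They are functions on \<^typ>\<open>nat\<close> here,
  and their value at 0 is never used.
\<close>

abbreviation unit_leb :: "real measure" where
  "unit_leb \<equiv> lebesgue_on {0..<1}"

text \<open>
  A finite or infinite sequence of pairwise disjoint sets is given by the countable set of
  its members; as in the sequence version, the empty set may occur among them.
\<close>

definition unit_partition :: "real set set \<Rightarrow> bool" where
  "unit_partition P \<longleftrightarrow>
     countable P \<and> P \<subseteq> sets lebesgue \<and> disjoint P \<and> \<Union>P = {0..<1}"

definition partition_filtration :: "(nat \<Rightarrow> real set set) \<Rightarrow> bool" where
  "partition_filtration \<A> \<longleftrightarrow>
     (\<forall>n\<ge>1. unit_partition (\<A> n)) \<and>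
     (\<forall>n\<ge>1. \<forall>A\<in>\<A> n. \<exists>C\<subseteq>\<A> (n + 1). A = \<Union>C)"

definition martingale_difference_on ::
  "(nat \<Rightarrow> real set set) \<Rightarrow> (nat \<Rightarrow> real \<Rightarrow> real) \<Rightarrow> bool" where
  "martingale_difference_on \<A> f \<longleftrightarrow>
     partition_filtration \<A> \<and>
     (\<forall>n\<ge>1. integrable unit_leb (f n)) \<and>
     (\<forall>n\<ge>1. \<forall>A\<in>\<A> n. f n constant_on A) \<and>
     (\<forall>n\<ge>2. \<forall>A\<in>\<A> (n - 1). (LINT x:A|lebesgue. f n x) = 0)"

definition martingale_difference :: "(nat \<Rightarrow> real \<Rightarrow> real) \<Rightarrow> bool" where
  "martingale_difference f \<longleftrightarrow> (\<exists>\<A>. martingale_difference_on \<A> f)"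

definition square_integrable :: "(real \<Rightarrow> real) \<Rightarrow> bool" where
  "square_integrable g \<longleftrightarrow>
     g \<in> borel_measurable unit_leb \<and> integrable unit_leb (\<lambda>x. (g x)\<^sup>2)"

definition L2_norm :: "(real \<Rightarrow> real) \<Rightarrow> real" where
  "L2_norm g = sqrt (LINT x|unit_leb. (g x)\<^sup>2)"

definition orthonormal_system :: "(nat \<Rightarrow> real \<Rightarrow> real) \<Rightarrow> bool" where
  "orthonormal_system \<phi> \<longleftrightarrow>
     (\<forall>n\<ge>1. square_integrable (\<phi> n)) \<and>
     (\<forall>m\<ge>1. \<forall>n\<ge>1. (LINT x|unit_leb. \<phi> m x * \<phi> n x) = (if m = n then 1 else 0))"

text \<open>
  The terms with index \<open>n \<ge> 1\<close> are written with \<open>Suc n\<close>. Since \<^const>\<open>summable\<close> refers to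
  the limit of the partial sums, the convergence of the function series is not
  required to be absolute.
\<close>

definition C_multiplier :: "(nat \<Rightarrow> real) \<Rightarrow> (nat \<Rightarrow> real \<Rightarrow> real) \<Rightarrow> bool" where
  "C_multiplier \<omega> \<phi> \<longleftrightarrow>
     mono_on {1..} \<omega> \<and> filterlim \<omega> at_top sequentially \<and>
     orthonormal_system \<phi> \<and>
     (\<forall>a :: nat \<Rightarrow> real.
        summable (\<lambda>n. (a (Suc n))\<^sup>2 * \<omega> (Suc n)) \<longrightarrow>
        (AE x in unit_leb. summable (\<lambda>n. a (Suc n) * \<phi> (Suc n) x)))"

end

theory Submission
  imports Defs "HOL-Probability.Conditional_Expectation"
begin

text \<open>
  Coefficientwise truncation of a martingale in at most \<open>2 ^ r\<close> different ways gives a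
  martingale with values in a space \<open>\<ell>\<^sup>2\<^sup>r\<close> of this dimension, on which the norm is comparable to
  the maximum norm. This norm is 2-smooth with a constant of order \<open>r\<close>, so the maximum of all
  the truncations has squared \<open>L\<^sup>2\<close> norm at most of order \<open>r\<close> times that of the whole sum; no
  regularity of the filtration is needed, because the square function is never used. Applied
  to the partial sums of \<open>\<Sum>\<^sub>n a\<^sub>n p\<^sub>n\<close> between the indices \<open>2 ^ 2 ^ k\<close> and \<open>2 ^ 2 ^ (k + 1)\<close>, this bounds
  their oscillation by the corresponding block of \<open>\<Sum>\<^sub>n a\<^sub>n\<^sup>2 log n\<close>, and the sums of the whole
  blocks converge absolutely almost everywhere by the Cauchy-Schwarz inequality.
\<close>

subsection \<open>Smoothness of even power norms\<close>

text \<open>This is the Hoelder inequality on at most \<open>2 ^ Suc q\<close> indices: the factor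
  lost is the number of indices to the power \<open>1 / Suc q\<close>, which is at most 2. This ties
  the exponent to the number of coordinates.\<close>

lemma sum_even_power_le:
  fixes x :: "'i \<Rightarrow> real" and a :: real
  assumes "finite I" "card I \<le> 2 ^ Suc q" "q \<ge> 1" "a > 0"
  defines "g \<equiv> a + (\<Sum>m\<in>I. x m ^ (2 * Suc q))"
  shows "(\<Sum>m\<in>I. x m ^ (2 * q)) \<le> 2 * g powr (1 - 1 / Suc q)"
proof -
  define r where "r = 1 / real (Suc q)"
  have r: "0 < r" "r < 1" using \<open>q \<ge> 1\<close> by (auto simp: r_def)
  have S0: "0 \<le> (\<Sum>m\<in>I. x m ^ (2 * Suc q))"
    by (intro sum_nonneg zero_le_even_power) simp
  have g: "g > 0" using S0 assms(4) by (simp add: g_def)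
  have two: "(2 ^ Suc q) powr r = (2::real)"
  proof -
    have "(2 ^ Suc q) powr r = (2 powr real (Suc q)) powr r"
      by (subst powr_realpow) auto
    also have "\<dots> = 2 powr (real (Suc q) * r)" by (rule powr_powr)
    finally show ?thesis by (simp add: r_def)
  qed
  \<comment> \<open>Young's inequality with weights \<open>1 - r\<close> and \<open>r\<close>
    compares each term with \<open>g / 2 ^ Suc q\<close>, an equal share of \<open>g\<close>. This
    share to the power \<open>r\<close> is \<open>g powr r / 2\<close>, the origin of the constant
    2.\<close>
  have term_le: "x m ^ (2 * q) * (g powr r / 2)
      \<le> (1 - r) * x m ^ (2 * Suc q) + r * (g / 2 ^ Suc q)" for m
  proof (cases "x m = 0")
    case True
    then show ?thesis using r g \<open>q \<ge> 1\<close> by (simp add: power_0_left)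
  next
    case False
    have "(x m ^ (2 * Suc q)) powr (1 - r) = (\<bar>x m\<bar> powr (2 * Suc q)) powr (1 - r)"
      using False by (subst powr_realpow) (auto simp: power_even_abs simp del: power_Suc mult_Suc_right)
    also have "\<dots> = \<bar>x m\<bar> powr (real (2 * Suc q) * (1 - r))" by (rule powr_powr)
    also have "real (2 * Suc q) * (1 - r) = real (2 * q)" by (simp add: r_def field_simps)
    also have "\<bar>x m\<bar> powr real (2 * q) = x m ^ (2 * q)"
      using False by (subst powr_realpow) (auto simp: power_even_abs)
    finally have *: "(x m ^ (2 * Suc q)) powr (1 - r) = x m ^ (2 * q)" .
    have "(x m ^ (2 * Suc q)) powr (1 - r) * (g / 2 ^ Suc q) powr r
      \<le> (1 - r) * x m ^ (2 * Suc q) + r * (g / 2 ^ Suc q)"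
      using r g False by (intro Youngs_inequality_0) (auto simp: zero_less_power_eq simp del: power_Suc mult_Suc_right)
    then show ?thesis unfolding * using g two by (simp add: powr_divide)
  qed
  have "(\<Sum>m\<in>I. x m ^ (2 * q)) * (g powr r / 2) = (\<Sum>m\<in>I. x m ^ (2 * q) * (g powr r / 2))"
    by (rule sum_distrib_right)
  also have "\<dots> \<le> (\<Sum>m\<in>I. (1 - r) * x m ^ (2 * Suc q) + r * (g / 2 ^ Suc q))"
    by (intro sum_mono term_le)
  also have "\<dots> = (1 - r) * (\<Sum>m\<in>I. x m ^ (2 * Suc q)) + real (card I) * (r * (g / 2 ^ Suc q))"
    by (simp add: sum.distrib sum_distrib_left)
  also have "\<dots> \<le> (1 - r) * g + 2 ^ Suc q * (r * (g / 2 ^ Suc q))"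
  proof (intro add_mono mult_mono)
    show "real (card I) \<le> 2 ^ Suc q"
      using assms(2) by (metis of_nat_le_iff of_nat_numeral of_nat_power)
  qed (use r g S0 assms(4) in \<open>auto simp: g_def\<close>)
  also have "\<dots> = g" by (simp add: algebra_simps)
  also have "g = g powr (1 - r) * g powr r" using g by (simp flip: powr_add)
  finally show ?thesis using g by (simp add: r_def)
qed

text \<open>The constant \<open>a > 0\<close> keeps the potential twice differentiable at the origin.\<close>

lemma even_norm_potential_le:
  fixes x y :: "'i \<Rightarrow> real" and a t :: real
  assumes "finite I" "card I \<le> 2 ^ Suc q" "q \<ge> 1" "a > 0" "\<And>m. m \<in> I \<Longrightarrow> \<bar>y m\<bar> \<le> 1"
  shows "(a + (\<Sum>m\<in>I. (x m + t * y m) ^ (2 * Suc q))) powr (1 / Suc q)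
    \<le> (a + (\<Sum>m\<in>I. x m ^ (2 * Suc q))) powr (1 / Suc q)
      + 2 * (\<Sum>m\<in>I. x m ^ (2 * q + 1) * y m)
          * (a + (\<Sum>m\<in>I. x m ^ (2 * Suc q))) powr (1 / Suc q - 1) * t
      + 4 * Suc q * t\<^sup>2"
proof (cases "t = 0")
  case True
  then show ?thesis by simp
next
  case False
  define r where "r = 1 / real (Suc q)"
  have r: "0 < r" "r < 1" using \<open>q \<ge> 1\<close> by (auto simp: r_def)
  define g where "g t = a + (\<Sum>m\<in>I. (x m + t * y m) ^ (2 * Suc q))" for t
  define g1 where "g1 t = (\<Sum>m\<in>I. (2 * Suc q) * (x m + t * y m) ^ (2 * q + 1) * y m)" for t
  define g2 where "g2 t = (\<Sum>m\<in>I. (2 * Suc q) * (2 * q + 1) * (x m + t * y m) ^ (2 * q) * (y m)\<^sup>2)" for t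
  have g: "g t > 0" for t
    unfolding g_def using assms(4) by (intro add_pos_nonneg sum_nonneg zero_le_even_power) auto
  have dg: "(g has_real_derivative g1 t) (at t)" for t
    unfolding g_def g1_def
    by (auto intro!: derivative_eq_intros sum.cong simp del: power_Suc)
  have dg1: "(g1 has_real_derivative g2 t) (at t)" for t
    unfolding g1_def g2_def
    by (auto intro!: derivative_eq_intros sum.cong simp: power2_eq_square simp del: power_Suc mult_Suc_right)
  define d0 where "d0 t = g t powr r" for t
  define d1 where "d1 t = r * g1 t * g t powr (r - 1)" for t
  define d2 where "d2 t = r * (g2 t * g t powr (r - 1) + (r - 1) * (g1 t)\<^sup>2 * g t powr (r - 2))" for t
  have D0: "(d0 has_real_derivative d1 t) (at t)" for t
    unfolding d0_def d1_def using g[of t]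
    by (auto intro!: derivative_eq_intros dg simp: algebra_simps powr_diff)
  have D1: "(d1 has_real_derivative d2 t) (at t)" for t
  proof -
    have "((\<lambda>t. g t powr (r - 1)) has_real_derivative (r - 1) * g t powr (r - 1 - 1) * g1 t) (at t)"
      using DERIV_fun_powr[OF dg[of t] g[of t], of "r - 1"] by simp
    then have "((\<lambda>t. g t powr (r - 1)) has_real_derivative (r - 1) * g1 t * g t powr (r - 2)) (at t)"
      by (simp add: mult_ac)
    from DERIV_cmult[OF DERIV_mult[OF dg1 this], of r] show ?thesis
      unfolding d1_def d2_def by (simp add: power2_eq_square algebra_simps)
  qed
  \<comment> \<open>The term of \<open>d2\<close> with \<open>(g1 t)\<^sup>2\<close> has the
    negative factor \<open>r - 1\<close> and is dropped. The other one is bounded by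
    \<open>sum_even_power_le\<close>, whose power of \<open>g\<close> cancels, so that only a
    constant of order \<open>q\<close> remains.\<close>
  have d2_le: "d2 t \<le> 8 * Suc q" for t
  proof -
    have "g2 t \<le> (\<Sum>m\<in>I. (2 * Suc q) * (2 * q + 1) * (x m + t * y m) ^ (2 * q) * 1)"
      unfolding g2_def
      by (intro sum_mono mult_left_mono)
        (use assms(5) in \<open>auto simp: abs_square_le_1 zero_le_even_power\<close>)
    also have "\<dots> = (2 * Suc q) * (2 * q + 1) * (\<Sum>m\<in>I. (x m + t * y m) ^ (2 * q))"
      by (simp add: sum_distrib_left)
    also have "\<dots> \<le> (2 * Suc q) * (2 * q + 1) * (2 * g t powr (1 - r))"
      unfolding g_def r_def by (intro mult_left_mono sum_even_power_le assms) auto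
    finally have "g2 t * g t powr (r - 1)
        \<le> (2 * Suc q) * (2 * q + 1) * (2 * g t powr (1 - r)) * g t powr (r - 1)"
      by (rule mult_right_mono) simp
    also have "\<dots> = (2 * Suc q) * (2 * q + 1) * 2 * (g t powr (1 - r) * g t powr (r - 1))" by simp
    also have "g t powr (1 - r) * g t powr (r - 1) = 1" using g[of t] by (simp flip: powr_add)
    finally have A: "g2 t * g t powr (r - 1) \<le> (2 * Suc q) * (2 * q + 1) * 2" by simp
    have "(r - 1) * (g1 t)\<^sup>2 * g t powr (r - 2) \<le> 0"
      using r by (intro mult_nonpos_nonneg) auto
    then have "d2 t \<le> r * ((2 * Suc q) * (2 * q + 1) * 2)"
      unfolding d2_def using A r by (intro mult_left_mono) auto
    also have "\<dots> = 4 * (2 * q + 1)" by (simp add: r_def field_simps)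
    finally show ?thesis by simp
  qed
  \<comment> \<open>Orders 0 to 2 suffice for an expansion about 0 with second order remainder. The
    Taylor formula concerns a point other than the centre, hence the separate case
    \<open>t = 0\<close>.\<close>
  define df where "df n = (if n = 0 then d0 else if n = 1 then d1 else d2)" for n :: nat
  have "\<forall>n s. n < 2 \<and> min 0 t \<le> s \<and> s \<le> max 0 t \<longrightarrow> (df n has_real_derivative df (Suc n) s) (at s)"
    using D0 D1 by (auto simp: df_def less_2_cases_iff)
  from Taylor[OF _ _ this, of d0 0 t] False
  obtain \<xi> where "d0 t = (\<Sum>n<2. df n 0 / fact n * (t - 0) ^ n) + df 2 \<xi> / fact 2 * (t - 0)\<^sup>2"
    by (auto simp: df_def)
  then have "d0 t = d0 0 + d1 0 * t + d2 \<xi> / 2 * t\<^sup>2"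
    by (simp add: df_def eval_nat_numeral)
  also have "\<dots> \<le> d0 0 + d1 0 * t + (8 * Suc q) / 2 * t\<^sup>2"
    using d2_le[of \<xi>] by (intro add_left_mono mult_right_mono divide_right_mono) auto
  also have "(8 * Suc q) / 2 = 4 * real (Suc q)" by simp
  finally have main: "d0 t \<le> d0 0 + d1 0 * t + 4 * Suc q * t\<^sup>2" by simp
  have "d1 0 = 2 * (\<Sum>m\<in>I. x m ^ (2 * q + 1) * y m) * (a + (\<Sum>m\<in>I. x m ^ (2 * Suc q))) powr (r - 1)"
  proof -
    have "r * g1 0 = (r * (2 * Suc q)) * (\<Sum>m\<in>I. x m ^ (2 * q + 1) * y m)"
      unfolding g1_def by (simp add: sum_distrib_left mult_ac)
    also have "r * (2 * Suc q) = 2" by (simp add: r_def field_simps)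
    finally show ?thesis by (simp add: d1_def g_def)
  qed
  with main show ?thesis by (simp add: d0_def g_def r_def)
qed

text \<open>Each even power is at most the base of the potential, so the negative power of this base
  absorbs all but one factor \<open>\<bar>x m\<bar>\<close>. Linear growth makes the first order
  term integrable for square integrable martingales.\<close>

lemma even_norm_potential_deriv_bound:
  fixes x y :: "'i \<Rightarrow> real" and a :: real
  assumes "finite I" "a > 0" "\<And>m. m \<in> I \<Longrightarrow> \<bar>y m\<bar> \<le> 1"
  shows "\<bar>2 * (\<Sum>m\<in>I. x m ^ (2 * q + 1) * y m)
          * (a + (\<Sum>m\<in>I. x m ^ (2 * Suc q))) powr (1 / Suc q - 1)\<bar> \<le> 2 * (\<Sum>m\<in>I. \<bar>x m\<bar>)"
proof -
  define r where "r = 1 / real (Suc q)"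
  define g where "g = a + (\<Sum>m\<in>I. x m ^ (2 * Suc q))"
  have S0: "0 \<le> (\<Sum>m\<in>I. x m ^ (2 * Suc q))"
    by (intro sum_nonneg zero_le_even_power) simp
  have g: "g > 0" using S0 assms(2) by (simp add: g_def)
  have *: "\<bar>x m ^ (2 * q + 1) * y m\<bar> * g powr (r - 1) \<le> \<bar>x m\<bar>" if "m \<in> I" for m
  proof (cases "x m = 0")
    case False
    have "x m ^ (2 * Suc q) \<le> g"
      unfolding g_def using member_le_sum[of m I "\<lambda>m. x m ^ (2 * Suc q)"] assms that
      by (simp add: zero_le_even_power del: power_Suc mult_Suc_right)
    then have "g powr (r - 1) \<le> (x m ^ (2 * Suc q)) powr (r - 1)"
      using False g by (intro powr_mono2') (auto simp: r_def zero_less_power_eq simp del: power_Suc mult_Suc_right)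
    also have "\<dots> = (\<bar>x m\<bar> powr (2 * Suc q)) powr (r - 1)"
      using False by (subst powr_realpow) (auto simp: power_even_abs simp del: power_Suc mult_Suc_right)
    also have "\<dots> = \<bar>x m\<bar> powr (real (2 * Suc q) * (r - 1))" by (rule powr_powr)
    also have "real (2 * Suc q) * (r - 1) = - real (2 * q)" by (simp add: r_def field_simps)
    also have "\<bar>x m\<bar> powr - real (2 * q) = 1 / x m ^ (2 * q)"
      using False by (subst powr_minus, subst powr_realpow) (auto simp: power_even_abs divide_simps)
    finally have "g powr (r - 1) \<le> 1 / x m ^ (2 * q)" .
    then have "\<bar>x m ^ (2 * q + 1) * y m\<bar> * g powr (r - 1) \<le> (\<bar>x m ^ (2 * q + 1)\<bar> * 1) * (1 / x m ^ (2 * q))"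
      using assms(3)[OF that] unfolding abs_mult by (intro mult_mono) (auto intro!: mult_left_le)
    also have "\<dots> = \<bar>x m\<bar>" using False by (simp add: abs_mult power_abs power_even_abs)
    finally show ?thesis .
  qed simp
  have "\<bar>(\<Sum>m\<in>I. x m ^ (2 * q + 1) * y m)\<bar> * g powr (r - 1)
      \<le> (\<Sum>m\<in>I. \<bar>x m ^ (2 * q + 1) * y m\<bar>) * g powr (r - 1)"
    by (intro mult_right_mono sum_abs) auto
  also have "\<dots> = (\<Sum>m\<in>I. \<bar>x m ^ (2 * q + 1) * y m\<bar> * g powr (r - 1))"
    by (rule sum_distrib_right)
  also have "\<dots> \<le> (\<Sum>m\<in>I. \<bar>x m\<bar>)" by (intro sum_mono *)
  finally show ?thesis by (simp add: abs_mult g_def r_def)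
qed

text \<open>The base contains the power of every single coordinate and the root is monotone, so the
  potential controls the maximum over all coordinates.\<close>

lemma square_le_even_norm_potential:
  fixes x :: "'i \<Rightarrow> real" and a :: real
  assumes "finite I" "a > 0" "m \<in> I"
  shows "(x m)\<^sup>2 \<le> (a + (\<Sum>m\<in>I. x m ^ (2 * Suc q))) powr (1 / Suc q)"
proof -
  have "(x m)\<^sup>2 = ((x m)\<^sup>2 ^ Suc q) powr (1 / Suc q)"
  proof (cases "x m = 0")
    case False
    have "((x m)\<^sup>2 ^ Suc q) powr (1 / Suc q) = ((x m)\<^sup>2 powr Suc q) powr (1 / Suc q)"
      using False by (subst powr_realpow) auto
    also have "\<dots> = (x m)\<^sup>2 powr (real (Suc q) * (1 / Suc q))" by (rule powr_powr)
    finally show ?thesis by simp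
  qed simp
  also have "(x m)\<^sup>2 ^ Suc q = x m ^ (2 * Suc q)" by (rule power_mult [symmetric])
  also have "(x m ^ (2 * Suc q)) powr (1 / Suc q) \<le> (a + (\<Sum>m\<in>I. x m ^ (2 * Suc q))) powr (1 / Suc q)"
  proof (rule powr_mono2)
    have "x m ^ (2 * Suc q) \<le> (\<Sum>m\<in>I. x m ^ (2 * Suc q))"
      using assms by (intro member_le_sum zero_le_even_power) auto
    then show "x m ^ (2 * Suc q) \<le> a + (\<Sum>m\<in>I. x m ^ (2 * Suc q))" using assms by simp
  qed (simp_all only: zero_le_even_power dvd_triv_left, simp)
  finally show ?thesis .
qed

subsection \<open>Truncations of martingales\<close>

lemma integrable_mult_squares:
  fixes f g :: "'a \<Rightarrow> real"
  assumes [measurable]: "f \<in> borel_measurable M" "g \<in> borel_measurable M"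
    and "integrable M (\<lambda>x. (f x)\<^sup>2)" "integrable M (\<lambda>x. (g x)\<^sup>2)"
  shows "integrable M (\<lambda>x. f x * g x)"
proof (rule Bochner_Integration.integrable_bound)
  show "integrable M (\<lambda>x. (f x)\<^sup>2 + (g x)\<^sup>2)" using assms by simp
  have "\<bar>u * v\<bar> \<le> u\<^sup>2 + v\<^sup>2" for u v :: real
    using sum_squares_bound[of "\<bar>u\<bar>" "\<bar>v\<bar>"] abs_ge_zero[of "u * v"]
    unfolding abs_mult power2_abs by linarith
  then show "AE x in M. norm (f x * g x) \<le> norm ((f x)\<^sup>2 + (g x)\<^sup>2)" by simp
qed measurable

lemma integrable_sum_squares:
  fixes f :: "'i \<Rightarrow> 'a \<Rightarrow> real"
  assumes "finite J" "\<And>j. j \<in> J \<Longrightarrow> f j \<in> borel_measurable M"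
    "\<And>j. j \<in> J \<Longrightarrow> integrable M (\<lambda>x. (f j x)\<^sup>2)"
  shows "integrable M (\<lambda>x. (\<Sum>j\<in>J. f j x)\<^sup>2)"
  unfolding power2_eq_square sum_product using assms
  by (intro Bochner_Integration.integrable_sum integrable_mult_squares) auto

text \<open>Testing on all sets of every earlier \<open>F m\<close> says that the conditional
  expectations vanish. The condition concerns \<open>n \<ge> 2\<close> only: the first difference
  may have a nonzero mean, as for differences based on partitions.\<close>

locale martingale_differences = finite_measure M for M :: "'a measure" +
  fixes F :: "nat \<Rightarrow> 'a measure" and d :: "nat \<Rightarrow> 'a \<Rightarrow> real"
  assumes subalgebra_F: "1 \<le> n \<Longrightarrow> subalgebra M (F n)"
    and subalgebra_mono: "1 \<le> m \<Longrightarrow> m \<le> n \<Longrightarrow> subalgebra (F n) (F m)"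
    and adapted: "1 \<le> n \<Longrightarrow> d n \<in> borel_measurable (F n)"
    and integrable_d: "1 \<le> n \<Longrightarrow> integrable M (d n)"
    and mean_zero: "1 \<le> m \<Longrightarrow> m < n \<Longrightarrow> A \<in> sets (F m) \<Longrightarrow> (LINT x:A|M. d n x) = 0"
begin

lemma measurable_d: "1 \<le> n \<Longrightarrow> d n \<in> borel_measurable M"
  using integrable_d by auto

lemma adapted_le: "1 \<le> n \<Longrightarrow> n \<le> m \<Longrightarrow> d n \<in> borel_measurable (F m)"
  by (rule measurable_from_subalg[OF subalgebra_mono adapted])

lemma cond_exp_d:
  assumes "1 \<le> m" "m < n"
  shows "AE x in M. real_cond_exp M (F m) (d n) x = 0"
proof -
  interpret finite_measure_subalgebra M "F m" by unfold_locales (use assms subalgebra_F in auto)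
  show ?thesis
    by (rule real_cond_exp_charact) (use assms mean_zero integrable_d in auto)
qed

text \<open>A factor known at the earlier time \<open>m\<close> can be taken out of the conditional
  expectation, which vanishes.\<close>

lemma integral_mult_d:
  assumes "1 \<le> m" "m < n" "g \<in> borel_measurable (F m)" "integrable M (\<lambda>x. g x * d n x)"
  shows "(LINT x|M. g x * d n x) = 0"
proof -
  interpret finite_measure_subalgebra M "F m" by unfold_locales (use assms subalgebra_F in auto)
  have "(LINT x|M. g x * d n x) = (LINT x|M. g x * real_cond_exp M (F m) (d n) x)"
    using assms measurable_d by (intro real_cond_exp_intg(2)[symmetric]) auto
  also have "\<dots> = (LINT x|M. 0)"
    using assms by (intro integral_cong_AE)
      (auto intro: measurable_from_subalg[OF subalg] intro!: eventually_mono[OF cond_exp_d[OF assms(1,2)]])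
  finally show ?thesis by simp
qed

text \<open>The partial sums of a square integrable sum are its conditional expectations, so they are
  square integrable by Jensen's inequality.\<close>

lemma integrable_square_component:
  assumes "finite J" "J \<subseteq> {1..}" "integrable M (\<lambda>x. (\<Sum>j\<in>J. d j x)\<^sup>2)" "i \<in> J"
  shows "integrable M (\<lambda>x. (d i x)\<^sup>2)"
  using assms
proof (induction arbitrary: i rule: finite_linorder_max_induct)
  case (insert b A)
  define S where "S x = (\<Sum>j\<in>A. d j x)" for x
  have A: "A \<subseteq> {1..}" "b \<ge> 1" using insert by auto
  have b: "b \<notin> A" using insert by auto
  have Sb: "(\<Sum>j\<in>insert b A. d j x) = S x + d b x" for x
    using insert.hyps b by (simp add: S_def)
  have Sb2: "integrable M (\<lambda>x. (S x + d b x)\<^sup>2)" using insert.prems(2) unfolding Sb .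
  have [measurable]: "d b \<in> borel_measurable M" using A measurable_d by auto
  have S_meas [measurable]: "S \<in> borel_measurable M"
    unfolding S_def using A by (intro borel_measurable_sum measurable_d) auto
  have S_int: "integrable M S" unfolding S_def using A integrable_d by auto
  have S2: "integrable M (\<lambda>x. (S x)\<^sup>2)"
  proof (cases "A = {}")
    case True
    then show ?thesis by (simp add: S_def)
  next
    case False
    define m where "m = Max A"
    have m: "1 \<le> m" "m < b" "\<And>j. j \<in> A \<Longrightarrow> j \<le> m"
      using False insert.hyps A unfolding m_def by (auto simp: subset_iff)
    interpret finite_measure_subalgebra M "F m" by unfold_locales (use m subalgebra_F in auto)
    have S_F: "S \<in> borel_measurable (F m)"
      unfolding S_def using m A by (intro borel_measurable_sum adapted_le) auto
    have "AE x in M. real_cond_exp M (F m) (\<lambda>x. S x + d b x) x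
        = real_cond_exp M (F m) S x + real_cond_exp M (F m) (d b) x"
      using S_int integrable_d A by (intro real_cond_exp_add) auto
    then have ce: "AE x in M. real_cond_exp M (F m) (\<lambda>x. S x + d b x) x = S x"
      using cond_exp_d[OF m(1,2)] real_cond_exp_F_meas[OF S_int S_F] by eventually_elim simp
    have "integrable M (\<lambda>x. (real_cond_exp M (F m) (\<lambda>x. S x + d b x) x)\<^sup>2)"
      by (rule integrable_convex_cond_exp[where I = UNIV])
        (use S_int integrable_d A Sb2 finite_emeasure_space in \<open>auto simp: convex_power2\<close>)
    then show ?thesis
      by (rule integrable_cong_AE_imp) (use ce in \<open>auto elim!: eventually_mono\<close>)
  qed
  \<comment> \<open>The last difference is the full sum minus \<open>S\<close>, and both are now
    known to be square integrable.\<close>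
  have "integrable M (\<lambda>x. 2 * (S x + d b x)\<^sup>2 + 2 * (S x)\<^sup>2)" using S2 Sb2 by simp
  then have "integrable M (\<lambda>x. (d b x)\<^sup>2)"
  proof (rule Bochner_Integration.integrable_bound)
    have "v\<^sup>2 \<le> 2 * (u + v)\<^sup>2 + 2 * u\<^sup>2" for u v :: real
      using zero_le_power2[of "2 * u + v"] by (simp add: power2_eq_square algebra_simps)
    then show "AE x in M. norm ((d b x)\<^sup>2) \<le> norm (2 * (S x + d b x)\<^sup>2 + 2 * (S x)\<^sup>2)"
      by simp
  qed measurable
  then show ?case using insert.IH[of i] insert.prems A S2 unfolding S_def by auto
qed simp

text \<open>In each product of two differences the indices are distinct, and the one with the larger
  index integrates to zero against the other.\<close>

lemma integral_mult_transforms: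
  assumes "finite J" "finite K" "J \<subseteq> {1..}" "K \<subseteq> {1..}" "J \<inter> K = {}"
    and "\<And>j. j \<in> J \<union> K \<Longrightarrow> integrable M (\<lambda>x. (d j x)\<^sup>2)"
  shows "(LINT x|M. (\<Sum>j\<in>J. d j x) * (\<Sum>k\<in>K. d k x)) = 0"
proof -
  have int: "integrable M (\<lambda>x. d j x * d k x)" if "j \<in> J" "k \<in> K" for j k
    using that assms by (intro integrable_mult_squares measurable_d) auto
  have "(LINT x|M. d j x * d k x) = 0" if jk: "j \<in> J" "k \<in> K" for j k
  proof (cases "j < k")
    case True
    then show ?thesis using jk assms by (intro integral_mult_d[of j] int adapted) auto
  next
    case False
    then have "k < j" using jk assms(5) by (metis disjoint_iff linorder_neqE_nat)
    then have "(LINT x|M. d k x * d j x) = 0"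
      using jk assms int[OF jk] by (intro integral_mult_d[of k] adapted) (auto simp: mult.commute)
    then show ?thesis by (simp add: mult.commute)
  qed
  then show ?thesis using int by (simp add: sum_product)
qed

lemma integral_square_sum:
  assumes "finite J" "J \<subseteq> {1..}" "\<And>j. j \<in> J \<Longrightarrow> integrable M (\<lambda>x. (d j x)\<^sup>2)"
  shows "(LINT x|M. (\<Sum>j\<in>J. d j x)\<^sup>2) = (\<Sum>j\<in>J. LINT x|M. (d j x)\<^sup>2)"
  using assms
proof (induction J)
  case (insert b A)
  define S where "S x = (\<Sum>j\<in>A. d j x)" for x
  have [measurable]: "d b \<in> borel_measurable M" "S \<in> borel_measurable M"
    unfolding S_def using insert.prems by (auto intro!: borel_measurable_sum measurable_d)
  have S2: "integrable M (\<lambda>x. (S x)\<^sup>2)"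
    unfolding S_def using insert by (intro integrable_sum_squares measurable_d) auto
  have b2: "integrable M (\<lambda>x. (d b x)\<^sup>2)" using insert by auto
  have cross: "integrable M (\<lambda>x. d b x * S x)" by (intro integrable_mult_squares S2 b2) auto
  have "(LINT x|M. d b x * S x) = 0"
    using integral_mult_transforms[of "{b}" A] insert unfolding S_def by auto
  moreover have "(\<Sum>j\<in>insert b A. d j x)\<^sup>2 = (d b x)\<^sup>2 + 2 * (d b x * S x) + (S x)\<^sup>2" for x
    using insert.hyps by (simp add: S_def power2_eq_square algebra_simps)
  ultimately show ?case
    using insert.IH insert.prems insert.hyps S2 b2 cross by (simp add: S_def)
qed simp

text \<open>The first order term of the expansion of the potential is a function of the earlier
  differences times the last one, so it has mean zero.\<close>

lemma even_norm_potential_transforms: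
  fixes y :: "nat \<Rightarrow> 'i \<Rightarrow> real"
  assumes "finite J" "J \<subseteq> {1..}" "\<And>j. j \<in> J \<Longrightarrow> integrable M (\<lambda>x. (d j x)\<^sup>2)"
    and I: "finite I" "card I \<le> 2 ^ Suc q" "q \<ge> 1" "a > 0"
    and y: "\<And>j m. j \<in> J \<Longrightarrow> m \<in> I \<Longrightarrow> \<bar>y j m\<bar> \<le> 1"
  defines "\<Phi> \<equiv> \<lambda>J x. (a + (\<Sum>m\<in>I. (\<Sum>j\<in>J. d j x * y j m) ^ (2 * Suc q))) powr (1 / Suc q)"
  shows "integrable M (\<Phi> J) \<and> integral\<^sup>L M (\<Phi> J)
    \<le> a powr (1 / Suc q) * measure M (space M) + 4 * Suc q * (\<Sum>j\<in>J. LINT x|M. (d j x)\<^sup>2)"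
  using assms(1-3) y
proof (induction rule: finite_linorder_max_induct)
  case empty
  then show ?case by (simp add: \<Phi>_def)
next
  case (insert b A)
  define T where "T m x = (\<Sum>j\<in>A. d j x * y j m)" for m x
  define \<psi> where "\<psi> x = 2 * (\<Sum>m\<in>I. T m x ^ (2 * q + 1) * y b m)
      * (a + (\<Sum>m\<in>I. T m x ^ (2 * Suc q))) powr (1 / Suc q - 1)" for x
  have A: "A \<subseteq> {1..}" "b \<ge> 1" "b \<notin> A" using insert by auto
  have IH: "integrable M (\<Phi> A)" "integral\<^sup>L M (\<Phi> A)
    \<le> a powr (1 / Suc q) * measure M (space M) + 4 * Suc q * (\<Sum>j\<in>A. LINT x|M. (d j x)\<^sup>2)"
    using insert A by auto
  have db2: "integrable M (\<lambda>x. (d b x)\<^sup>2)" using insert by auto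
  have db [measurable]: "d b \<in> borel_measurable M" using A measurable_d by auto
  have T_meas [measurable]: "T m \<in> borel_measurable M" for m
    unfolding T_def using A by (intro borel_measurable_sum borel_measurable_times measurable_d) auto
  have T2: "integrable M (\<lambda>x. (T m x)\<^sup>2)" for m
    unfolding T_def using insert A
    by (intro integrable_sum_squares borel_measurable_times measurable_d) (auto simp: power_mult_distrib)
  have \<psi>_meas [measurable]: "\<psi> \<in> borel_measurable M" unfolding \<psi>_def by measurable
  have \<Phi>_ins: "\<Phi> (insert b A) x = (a + (\<Sum>m\<in>I. (T m x + d b x * y b m) ^ (2 * Suc q))) powr (1 / Suc q)"
    and \<Phi>_A: "\<Phi> A x = (a + (\<Sum>m\<in>I. T m x ^ (2 * Suc q))) powr (1 / Suc q)" for x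
    using A insert.hyps by (simp_all add: \<Phi>_def T_def add.commute del: power_Suc mult_Suc_right)
  have step: "\<Phi> (insert b A) x \<le> \<Phi> A x + \<psi> x * d b x + 4 * Suc q * (d b x)\<^sup>2" for x
    unfolding \<Phi>_ins \<Phi>_A \<psi>_def using insert.prems by (intro even_norm_potential_le I) auto
  have \<psi>_bound: "\<bar>\<psi> x\<bar> \<le> 2 * (\<Sum>m\<in>I. \<bar>T m x\<bar>)" for x
    unfolding \<psi>_def using insert.prems by (intro even_norm_potential_deriv_bound I) auto
  \<comment> \<open>The linear growth of \<open>\<psi>\<close> reduces this to a product of two
    square integrable functions.\<close>
  have \<psi>d: "integrable M (\<lambda>x. \<psi> x * d b x)"
  proof (rule Bochner_Integration.integrable_bound)
    show "integrable M (\<lambda>x. 2 * (\<Sum>m\<in>I. \<bar>T m x\<bar>) * \<bar>d b x\<bar>)"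
    proof (rule integrable_mult_squares)
      have "integrable M (\<lambda>x. (\<Sum>m\<in>I. \<bar>T m x\<bar>)\<^sup>2)"
        using I T2 by (intro integrable_sum_squares) auto
      then show "integrable M (\<lambda>x. (2 * (\<Sum>m\<in>I. \<bar>T m x\<bar>))\<^sup>2)"
        by (simp add: power_mult_distrib)
    qed (use db2 in auto)
    show "AE x in M. norm (\<psi> x * d b x) \<le> norm (2 * (\<Sum>m\<in>I. \<bar>T m x\<bar>) * \<bar>d b x\<bar>)"
    proof (rule AE_I2)
      fix x
      have "\<bar>\<psi> x\<bar> * \<bar>d b x\<bar> \<le> \<bar>2 * (\<Sum>m\<in>I. \<bar>T m x\<bar>)\<bar> * \<bar>d b x\<bar>"
        using \<psi>_bound[of x] by (intro mult_right_mono) auto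
      then show "norm (\<psi> x * d b x) \<le> norm (2 * (\<Sum>m\<in>I. \<bar>T m x\<bar>) * \<bar>d b x\<bar>)"
        by (simp add: abs_mult)
    qed
  qed measurable
  have \<psi>0: "(LINT x|M. \<psi> x * d b x) = 0"
  \<comment> \<open>Without earlier indices there is no sigma-algebra to condition on; then all
    \<open>T m\<close> and hence \<open>\<psi>\<close> vanish, so a nonzero mean of
    \<open>d b\<close> does no harm.\<close>
  proof (cases "A = {}")
    case True
    then show ?thesis by (simp add: \<psi>_def T_def)
  next
    case False
    define m where "m = Max A"
    have m: "1 \<le> m" "m < b" "\<And>j. j \<in> A \<Longrightarrow> j \<le> m"
      using False insert.hyps A unfolding m_def by (auto simp: subset_iff)
    have [measurable]: "T i \<in> borel_measurable (F m)" for i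
      unfolding T_def using m A by (intro borel_measurable_sum borel_measurable_times adapted_le) auto
    have "\<psi> \<in> borel_measurable (F m)" unfolding \<psi>_def by measurable
    then show ?thesis using m \<psi>d by (intro integral_mult_d[of m])
  qed
  have upper: "integrable M (\<lambda>x. \<Phi> A x + \<psi> x * d b x + 4 * Suc q * (d b x)\<^sup>2)"
    using IH(1) \<psi>d db2 by simp
  \<comment> \<open>Nonnegativity of the potential turns the one-sided bound \<open>step\<close>
    into a bound for the absolute value.\<close>
  have \<Phi>_int: "integrable M (\<Phi> (insert b A))"
  proof (rule Bochner_Integration.integrable_bound[OF upper])
    show "\<Phi> (insert b A) \<in> borel_measurable M" unfolding \<Phi>_ins by measurable
    have "0 \<le> \<Phi> (insert b A) x" for x by (simp add: \<Phi>_def)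
    then show "AE x in M. norm (\<Phi> (insert b A) x) \<le> norm (\<Phi> A x + \<psi> x * d b x + 4 * Suc q * (d b x)\<^sup>2)"
      using step by (intro AE_I2) (smt (verit) real_norm_def)
  qed
  have "integral\<^sup>L M (\<Phi> (insert b A)) \<le> (LINT x|M. \<Phi> A x + \<psi> x * d b x + 4 * Suc q * (d b x)\<^sup>2)"
    by (intro integral_mono \<Phi>_int upper step)
  also have "\<dots> = integral\<^sup>L M (\<Phi> A) + 4 * Suc q * (LINT x|M. (d b x)\<^sup>2)"
    using IH(1) \<psi>d db2 \<psi>0 by simp
  finally show ?case
    using \<Phi>_int IH(2) insert.hyps A by (simp add: algebra_simps)
qed

end

subsection \<open>Almost everywhere convergence by blocks\<close>

text \<open>By monotone convergence the sum of the \<open>V k\<close> has a finite integral, so it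
  is finite almost everywhere.\<close>

lemma AE_summable_if_summable_integral:
  fixes V :: "nat \<Rightarrow> 'a \<Rightarrow> real"
  assumes int: "\<And>k. integrable M (V k)" and nonneg: "\<And>k x. V k x \<ge> 0"
    and sum: "summable (\<lambda>k. integral\<^sup>L M (V k))"
  shows "AE x in M. summable (\<lambda>k. V k x)"
proof -
  have [measurable]: "\<And>k. V k \<in> borel_measurable M" using int by auto
  have "(\<integral>\<^sup>+x. (\<Sum>k. ennreal (V k x)) \<partial>M) = (\<Sum>k. \<integral>\<^sup>+x. V k x \<partial>M)"
    by (rule nn_integral_suminf) measurable
  also have "\<dots> = (\<Sum>k. ennreal (integral\<^sup>L M (V k)))"
    using nonneg int by (simp add: nn_integral_eq_integral)
  also have "\<dots> = ennreal (\<Sum>k. integral\<^sup>L M (V k))"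
    using nonneg sum by (intro suminf_ennreal2) (auto intro: integral_nonneg_AE)
  finally have "(\<integral>\<^sup>+x. (\<Sum>k. ennreal (V k x)) \<partial>M) \<noteq> \<infinity>" by simp
  then have "AE x in M. (\<Sum>k. ennreal (V k x)) \<noteq> \<infinity>"
    by (intro nn_integral_PInf_AE) auto
  then show ?thesis
    by eventually_elim (use nonneg in \<open>auto intro: summable_suminf_not_top\<close>)
qed

text \<open>The sums over whole blocks give convergence of the partial sums along \<open>N\<close>,
  and \<open>V k\<close> controls the oscillation inside block \<open>k\<close>.\<close>

lemma summable_if_blocks:
  fixes g :: "nat \<Rightarrow> real" and N :: "nat \<Rightarrow> nat"
  assumes N: "strict_mono N"
    and blocks: "summable (\<lambda>k. \<Sum>i\<in>{N k..<N (Suc k)}. g i)"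
    and V: "V \<longlonglongrightarrow> 0"
    and bound: "\<And>k n. N k \<le> n \<Longrightarrow> n < N (Suc k) \<Longrightarrow> (\<Sum>i\<in>{N k..<n}. g i)\<^sup>2 \<le> V k"
  shows "summable g"
proof -
  define s where "s n = (\<Sum>i<n. g i)" for n
  have split: "s n = s m + (\<Sum>i\<in>{m..<n}. g i)" if "m \<le> n" for m n
    using that by (simp add: s_def flip: atLeast0LessThan) (metis le0 sum.atLeastLessThan_concat)
  have sN: "s (N k) = s (N 0) + (\<Sum>l<k. \<Sum>i\<in>{N l..<N (Suc l)}. g i)" for k
  proof (induction k)
    case (Suc k)
    then show ?case using split[of "N k" "N (Suc k)"] N by (simp add: strict_mono_less_eq)
  qed simp
  obtain D where "(\<lambda>k. \<Sum>l<k. \<Sum>i\<in>{N l..<N (Suc l)}. g i) \<longlonglongrightarrow> D"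
    using blocks unfolding summable_def sums_def by blast
  then have lim: "(\<lambda>k. s (N k)) \<longlonglongrightarrow> s (N 0) + D"
    by (subst sN) (intro tendsto_add tendsto_const)
  have "s \<longlonglongrightarrow> s (N 0) + D"
  proof (rule LIMSEQ_I)
    fix e :: real assume "e > 0"
    then obtain K1 where K1: "\<And>k. k \<ge> K1 \<Longrightarrow> norm (s (N k) - (s (N 0) + D)) < e / 2"
      using LIMSEQ_D[OF lim, of "e / 2"] by auto
    obtain K2 where K2: "\<And>k. k \<ge> K2 \<Longrightarrow> norm (V k - 0) < (e / 2)\<^sup>2"
      using LIMSEQ_D[OF V, of "(e / 2)\<^sup>2"] \<open>e > 0\<close> by auto
    define K where "K = max K1 K2"
    have "norm (s n - (s (N 0) + D)) < e" if n: "n \<ge> N K" for n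
    proof -
      \<comment> \<open>This is the block containing \<open>n\<close>. Minimality gives
        \<open>N k \<le> n\<close> unless \<open>k = 0\<close>; in that case
        \<open>K \<le> k\<close> forces \<open>K = 0\<close>, and the bound is
        \<open>n \<ge> N K\<close>.\<close>
      define k where "k = (LEAST k. n < N (Suc k))"
      have "n < N (Suc n)" using seq_suble[OF N, of "Suc n"] by simp
      then have k1: "n < N (Suc k)" unfolding k_def by (rule LeastI)
      have k2: "N k \<le> n" if "k \<noteq> 0"
        using not_less_Least[of "k - 1" "\<lambda>k. n < N (Suc k)"] that unfolding k_def by fastforce
      have "N K < N (Suc k)" using n k1 by simp
      then have "K \<le> k" using strict_mono_less[OF N] by simp
      have k3: "N k \<le> n" using k2 n \<open>K \<le> k\<close> by (cases "k = 0") auto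
      have "(\<Sum>i\<in>{N k..<n}. g i)\<^sup>2 < (e / 2)\<^sup>2"
        using bound[OF k3 k1] K2[of k] \<open>K \<le> k\<close> by (auto simp: K_def)
      then have "\<bar>\<Sum>i\<in>{N k..<n}. g i\<bar> < e / 2"
        using \<open>e > 0\<close> abs_le_square_iff[of "e / 2" "\<Sum>i\<in>{N k..<n}. g i"] by linarith
      moreover have "\<bar>s (N k) - (s (N 0) + D)\<bar> < e / 2" using K1[of k] \<open>K \<le> k\<close> by (simp add: K_def)
      ultimately show ?thesis using split[OF k3] unfolding real_norm_def by linarith
    qed
    then show "\<exists>no. \<forall>n\<ge>no. norm (s n - (s (N 0) + D)) < e" by blast
  qed
  then show ?thesis unfolding s_def summable_def sums_def by blast
qed

lemma summable_block_sums:
  fixes u :: "nat \<Rightarrow> real"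
  assumes "mono N" "summable u" "\<And>i. u i \<ge> 0"
  shows "summable (\<lambda>k. \<Sum>i\<in>{N k..<N (Suc k)}. u i)"
proof (rule summableI_nonneg_bounded)
  fix n
  have "(\<Sum>k<n. \<Sum>i\<in>{N k..<N (Suc k)}. u i) = (\<Sum>i\<in>{N 0..<N n}. u i)"
  proof (induction n)
    case (Suc n)
    then show ?case using \<open>mono N\<close> by (simp add: sum.atLeastLessThan_concat monoD)
  qed simp
  also have "\<dots> \<le> suminf u" using assms by (intro sum_le_suminf) auto
  finally show "(\<Sum>k<n. \<Sum>i\<in>{N k..<N (Suc k)}. u i) \<le> suminf u" .
qed (use assms in \<open>auto intro: sum_nonneg\<close>)

section \<open>Convergence of series of disjoint blocks of differences\<close>

context martingale_differences
begin

text \<open>Coefficients are absorbed into the differences in this way, so the convergence result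
  can be stated for plain sums.\<close>

lemma scale: "martingale_differences M F (\<lambda>n x. c n * d n x)"
proof unfold_locales
  fix m n A assume "1 \<le> m" "m < n" "A \<in> sets (F m)"
  then show "(LINT x:A|M. c n * d n x) = 0" using mean_zero by simp
qed (use subalgebra_F subalgebra_mono adapted integrable_d in auto)

text \<open>The block of indices from \<open>2 ^ 2 ^ k\<close> to \<open>2 ^ 2 ^ (k + 1)\<close> is treated with the exponent
  \<open>2 * 2 ^ (k + 1)\<close>: it is large enough for the number of partial sums in the block, and at most
  four times the logarithm of each index.\<close>

lemma AE_summable_disjoint_blocks:
  assumes fin: "\<And>i. finite (G i)" and sub: "\<And>i. G i \<subseteq> {1..}" and disj: "disjoint_family G"
    and sq: "\<And>i. integrable M (\<lambda>x. (\<Sum>j\<in>G i. d j x)\<^sup>2)"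
    and sum: "summable (\<lambda>i. (LINT x|M. (\<Sum>j\<in>G i. d j x)\<^sup>2) * log 2 (Suc i))"
  shows "AE x in M. summable (\<lambda>i. \<Sum>j\<in>G i. d j x)"
proof -
  define P where "P i x = (\<Sum>j\<in>G i. d j x)" for i x
  define v where "v i = (LINT x|M. (P i x)\<^sup>2)" for i
  \<comment> \<open>The first block starts at \<open>N 0 = 2\<close>; the two terms before it do not
    affect convergence. The term with index \<open>i\<close> is number \<open>i + 1\<close>, hence
    the weight \<open>log 2 (Suc i)\<close>.\<close>
  define N :: "nat \<Rightarrow> nat" where "N k = 2 ^ 2 ^ k" for k
  define J where "J k n = (\<Union>i\<in>{N k..<n}. G i)" for k n
  define b where "b k = (\<Sum>i\<in>{N k..<N (Suc k)}. v i)" for k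
  define w where "w k = (\<Sum>i\<in>{N k..<N (Suc k)}. v i * log 2 (Suc i))" for k
  define D where "D k x = (\<Sum>i\<in>{N k..<N (Suc k)}. P i x)" for k x
  have N: "strict_mono N" unfolding strict_mono_Suc_iff N_def by simp
  have v0: "v i \<ge> 0" for i unfolding v_def by simp
  have d2: "integrable M (\<lambda>x. (d j x)\<^sup>2)" if "j \<in> G i" for i j
    using integrable_square_component[OF fin sub sq that] .
  have J: "finite (J k n)" "J k n \<subseteq> {1..}" "j \<in> J k n \<Longrightarrow> integrable M (\<lambda>x. (d j x)\<^sup>2)" for j k n
    using fin sub d2 by (auto simp: J_def)
  have sumJ: "(\<Sum>j\<in>J k n. h j) = (\<Sum>i\<in>{N k..<n}. \<Sum>j\<in>G i. h j)" for h :: "nat \<Rightarrow> real" and k n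
    unfolding J_def using fin disj by (intro sum.UNION_disjoint) (auto simp: disjoint_family_on_def)
  have sum_d2: "(\<Sum>j\<in>J k (N (Suc k)). LINT x|M. (d j x)\<^sup>2) = b k" for k
    unfolding sumJ b_def v_def P_def
    using integral_square_sum[OF fin sub d2] by (intro sum.cong) auto
  have b0: "b k \<ge> 0" for k unfolding b_def by (intro sum_nonneg v0)
  \<comment> \<open>An index \<open>i \<ge> N k\<close> has
    \<open>log 2 (Suc i) \<ge> 2 ^ k\<close>, so the multiplier pays for a loss of
    \<open>2 ^ k\<close> in block \<open>k\<close>.\<close>
  have bw: "2 ^ k * b k \<le> w k" for k
    unfolding b_def w_def sum_distrib_left
  proof (rule sum_mono)
    fix i assume "i \<in> {N k..<N (Suc k)}"
    then have "(2::real) ^ 2 ^ k \<le> Suc i"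
      unfolding N_def by (simp add: le_SucI numeral_power_le_of_nat_cancel_iff del: of_nat_Suc)
    then have "log 2 (2 ^ 2 ^ k) \<le> log 2 (Suc i)" by (subst log_le_cancel_iff) auto
    then have "2 ^ k \<le> log 2 (Suc i)" by (simp add: log_nat_power)
    then show "2 ^ k * v i \<le> v i * log 2 (Suc i)"
      using v0 by (simp add: mult.commute mult_left_mono)
  qed
  have w: "summable w"
    unfolding w_def using N sum v0 by (intro summable_block_sums) (auto simp: strict_mono_mono v_def P_def)
  \<comment> \<open>\<open>Suc (q k)\<close> is the binary logarithm of \<open>N (Suc k)\<close>,
    which bounds the number of coordinates.\<close>
  define q where "q k = 2 ^ Suc k - (1::nat)" for k
  have q: "Suc (q k) = 2 ^ Suc k" "q k \<ge> 1" for k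
  proof -
    have "(1::nat) \<le> 2 ^ k" by simp
    then show "Suc (q k) = 2 ^ Suc k" "q k \<ge> 1" unfolding q_def power_Suc by linarith+
  qed
  \<comment> \<open>The coordinates are the endpoints \<open>n\<close> of partial sums; the 0-1
    multipliers keep the polynomials of the block before \<open>n\<close>.\<close>
  define y where "y k j n = (if j \<in> J k n then 1 else 0 :: real)" for k j n
  \<comment> \<open>The root of \<open>a k\<close> is \<open>(1 / 2) ^ k\<close>, so the constant in
    the potential contributes a summable amount to the integrals.\<close>
  define a where "a k = ((1 / 2 :: real) ^ k) ^ Suc (q k)" for k
  have a: "a k > 0" for k by (simp add: a_def)
  have a_root: "a k powr (1 / Suc (q k)) = (1 / 2) ^ k" for k
    unfolding a_def by (subst powr_realpow [symmetric], simp, subst powr_powr) simp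
  define V where "V k x = (a k + (\<Sum>n\<in>{N k..<N (Suc k)}.
    (\<Sum>j\<in>J k (N (Suc k)). d j x * y k j n) ^ (2 * Suc (q k)))) powr (1 / Suc (q k))" for k x
  have T: "(\<Sum>j\<in>J k (N (Suc k)). d j x * y k j n) = (\<Sum>i\<in>{N k..<n}. P i x)"
    if "n \<le> N (Suc k)" for k n x
  proof -
    have "{N k..<n} \<subseteq> {N k..<N (Suc k)}" using that by auto
    then have "J k n \<subseteq> J k (N (Suc k))" unfolding J_def by blast
    then have "(\<Sum>j\<in>J k (N (Suc k)). d j x * y k j n) = (\<Sum>j\<in>J k n. d j x)"
      using J(1) by (intro sum.mono_neutral_cong_right) (auto simp: y_def)
    then show ?thesis by (simp add: sumJ P_def)
  qed
  have V: "integrable M (V k) \<and> integral\<^sup>L M (V k)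
      \<le> a k powr (1 / Suc (q k)) * measure M (space M) + 4 * Suc (q k) * b k" for k
    unfolding V_def sum_d2 [symmetric]
  proof (rule even_norm_potential_transforms)
    have "N (Suc k) = 2 ^ Suc (q k)" by (simp only: N_def q)
    then show "card {N k..<N (Suc k)} \<le> 2 ^ Suc (q k)" by simp
  qed (use J q a in \<open>auto simp: y_def\<close>)
  \<comment> \<open>The smoothness constant \<open>4 * Suc (q k)\<close> equals
    \<open>8 * 2 ^ k\<close>, and \<open>bw\<close> turns it into the weighted block sum.\<close>
  have V_le: "integral\<^sup>L M (V k) \<le> (1 / 2) ^ k * measure M (space M) + 8 * w k" for k
    using V[of k, unfolded a_root, unfolded q(1)] bw[of k] by simp
  have V0: "V k x \<ge> 0" for k x by (simp add: V_def)
  have "summable (\<lambda>k. integral\<^sup>L M (V k))"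
  proof (rule summable_comparison_test')
    show "summable (\<lambda>k. (1 / 2) ^ k * measure M (space M) + 8 * w k)"
      using w by (intro summable_add summable_mult summable_mult2) auto
    show "norm (integral\<^sup>L M (V k)) \<le> (1 / 2) ^ k * measure M (space M) + 8 * w k" if "k \<ge> 0" for k
      using V_le[of k] integral_nonneg_AE[of "V k" M] V0 by auto
  qed
  then have AE_V: "AE x in M. summable (\<lambda>k. V k x)"
    using V V0 by (intro AE_summable_if_summable_integral) auto
  have D_d: "D k x = (\<Sum>j\<in>J k (N (Suc k)). d j x)" for k x
    by (simp add: D_def P_def sumJ)
  have D2: "integrable M (\<lambda>x. (D k x)\<^sup>2)" for k
    unfolding D_d using J(1,3) subsetD[OF J(2)] by (intro integrable_sum_squares measurable_d) auto
  have D2_eq: "(LINT x|M. (D k x)\<^sup>2) = b k" for k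
    unfolding D_d sum_d2 [symmetric] using J by (intro integral_square_sum) auto
  \<comment> \<open>Not only \<open>b k\<close> but also \<open>2 ^ k * b k\<close> is summable;
    this surplus makes the block sums converge absolutely.\<close>
  have "summable (\<lambda>k. LINT x|M. 2 ^ k * (D k x)\<^sup>2)"
    by (rule summable_comparison_test'[OF w])
      (use bw b0 in \<open>simp add: D2_eq abs_mult\<close>)
  then have AE_D: "AE x in M. summable (\<lambda>k. 2 ^ k * (D k x)\<^sup>2)"
    using D2 by (intro AE_summable_if_summable_integral) auto
  have "AE x in M. summable (\<lambda>i. P i x)"
    using AE_V AE_D
  proof eventually_elim
    case (elim x)
    show ?case
    proof (rule summable_if_blocks[OF N])
      show "(\<lambda>k. V k x) \<longlonglongrightarrow> 0" by (rule summable_LIMSEQ_zero) fact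
      show "(\<Sum>i\<in>{N k..<n}. P i x)\<^sup>2 \<le> V k x" if "N k \<le> n" "n < N (Suc k)" for k n
        using square_le_even_norm_potential[of "{N k..<N (Suc k)}" "a k" n
            "\<lambda>n. \<Sum>j\<in>J k (N (Suc k)). d j x * y k j n" "q k"] that a T[of n k x]
        unfolding V_def by simp
      \<comment> \<open>The inequality \<open>\<bar>u\<bar> \<le> 1 + u\<^sup>2\<close> for
        \<open>u = 2 ^ k * D k x\<close>, divided by \<open>2 ^ k\<close>, does the work of
        Cauchy-Schwarz pointwise.\<close>
      have D_le: "norm (D k x) \<le> (1 / 2) ^ k + 2 ^ k * (D k x)\<^sup>2" for k
      proof -
        have "\<bar>u\<bar> \<le> 1 + u\<^sup>2" for u :: real
          using sum_squares_bound[of "\<bar>u\<bar>" 1] by simp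
        moreover have "2 ^ k * ((1 / 2) ^ k + 2 ^ k * (D k x)\<^sup>2) = 1 + (2 ^ k * D k x)\<^sup>2"
          by (simp add: distrib_left power_mult_distrib power_one_over power2_eq_square)
        ultimately have "2 ^ k * \<bar>D k x\<bar> \<le> 2 ^ k * ((1 / 2) ^ k + 2 ^ k * (D k x)\<^sup>2)"
          by (metis abs_mult abs_numeral power_abs)
        then show ?thesis by simp
      qed
      have "summable (\<lambda>k. (1 / 2) ^ k + 2 ^ k * (D k x)\<^sup>2)"
        by (intro summable_add elim) auto
      then show "summable (\<lambda>k. \<Sum>i\<in>{N k..<N (Suc k)}. P i x)"
        unfolding D_def [symmetric] by (rule summable_comparison_test') (rule D_le)
    qed
  qed
  then show ?thesis by (simp add: P_def)
qed

end

subsection \<open>Sigma-algebras of countable partitions\<close>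

text \<open>Disjointness makes unions of members closed under complements, so nothing else is
  generated. Mean zero thus has to be checked on members only.\<close>

lemma sigma_sets_partition:
  assumes "disjoint P" "\<Union>P = \<Omega>" "B \<in> sigma_sets \<Omega> P"
  shows "\<exists>C\<subseteq>P. B = \<Union>C"
  using assms(3)
proof induction
  case (Basic A)
  then show ?case by (intro exI[of _ "{A}"]) auto
next
  case Empty
  then show ?case by (intro exI[of _ "{}"]) auto
next
  case (Compl B)
  then obtain C where C: "C \<subseteq> P" "B = \<Union>C" by blast
  then have "\<Omega> - B = \<Union>(P - C)" using assms(1,2) by (fastforce simp: disjoint_def)
  then show ?case by blast
next
  case (Union B)
  then obtain C where "\<And>i. C i \<subseteq> P \<and> B i = \<Union>(C i)" by metis
  then show ?case by (intro exI[of _ "\<Union>i. C i"]) auto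
qed

text \<open>Constancy makes every preimage a union of members, and countability makes this union
  measurable.\<close>

lemma borel_measurable_sigma_partition:
  assumes P: "countable P" "\<Union>P = \<Omega>" and const: "\<And>A. A \<in> P \<Longrightarrow> f constant_on A"
  shows "f \<in> borel_measurable (sigma \<Omega> P)"
proof (rule measurableI)
  fix B
  have sub: "P \<subseteq> Pow \<Omega>" using P by auto
  define C where "C = {A\<in>P. f ` A \<subseteq> B}"
  have "f -` B \<inter> space (sigma \<Omega> P) = \<Union>C"
  proof (intro equalityI subsetI)
    fix x assume "x \<in> f -` B \<inter> space (sigma \<Omega> P)"
    then obtain A where A: "x \<in> A" "A \<in> P" "f x \<in> B" using P sub by (auto simp: space_measure_of)
    then have "f ` A \<subseteq> B" using const[OF A(2)] unfolding constant_on_def by fastforce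
    then show "x \<in> \<Union>C" using A by (auto simp: C_def)
  qed (use P sub in \<open>auto simp: C_def space_measure_of\<close>)
  also have "\<Union>C \<in> sets (sigma \<Omega> P)"
    using P sub by (intro sets.countable_Union) (auto simp: C_def intro: countable_subset)
  finally show "f -` B \<inter> space (sigma \<Omega> P) \<in> sets (sigma \<Omega> P)" .
qed simp

lemma set_integral_Union_eq_0:
  fixes f :: "'a \<Rightarrow> real"
  assumes f: "integrable M f" and C: "countable C" "C \<subseteq> sets M" "disjoint C"
    and zero: "\<And>A. A \<in> C \<Longrightarrow> (LINT x:A|M. f x) = 0"
  shows "(LINT x:\<Union>C|M. f x) = 0"
proof -
  \<comment> \<open>Indices outside the enumeration of \<open>C\<close> get the empty set, so that a
    finite \<open>C\<close> is not listed with repetitions and countable additivity applies.\<close>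
  define A where "A i = (if i \<in> to_nat_on C ` C then from_nat_into C i else {})" for i
  have A: "A i = {} \<or> A i \<in> C" for i
    using C(1) by (auto simp: A_def from_nat_into_to_nat_on)
  have UN: "(\<Union>i. A i) = \<Union>C"
  proof (intro equalityI subsetI)
    fix x assume "x \<in> \<Union>C"
    then obtain B where B: "B \<in> C" "x \<in> B" by blast
    then have "A (to_nat_on C B) = B" using C(1) by (simp add: A_def)
    then show "x \<in> (\<Union>i. A i)" using B by blast
  qed (use A in blast)
  have "(LINT x:(\<Union>i. A i)|M. f x) = (\<Sum>i. LINT x:A i|M. f x)"
  proof (rule lebesgue_integral_countable_add)
    show meas: "A i \<in> sets M" for i using A[of i] C(2) by auto
    show "A i \<inter> A j = {}" if "i \<noteq> j" for i j
    proof (rule ccontr)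
      assume ne: "A i \<inter> A j \<noteq> {}"
      then obtain B B' where B: "B \<in> C" "i = to_nat_on C B" "B' \<in> C" "j = to_nat_on C B'"
        by (auto simp: A_def split: if_splits)
      then have "A i = B" "A j = B'" "B \<noteq> B'" using C(1) that by (auto simp: A_def)
      then show False using ne B C(3) by (auto dest: disjointD)
    qed
    show "set_integrable M (\<Union>i. A i) f"
      unfolding set_integrable_def using meas f by (intro integrable_mult_indicator) auto
  qed
  also have "\<dots> = (\<Sum>i. 0)"
  proof (rule suminf_cong)
    show "(LINT x:A i|M. f x) = 0" for i using A[of i] zero[of "A i"] by (auto simp: set_lebesgue_integral_def)
  qed
  finally show ?thesis by (simp add: UN)
qed

section \<open>Filtrations of partitions of the unit interval\<close>

lemma space_unit_leb: "space unit_leb = {0..<1}"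
  by (simp add: space_restrict_space)

text \<open>A member of a partition is a countable union of its children, so the generated
  sigma-algebras increase.\<close>

lemma martingale_differences_sigma:
  assumes "martingale_difference_on \<A> f"
  shows "martingale_differences unit_leb (\<lambda>n. sigma {0..<1} (\<A> n)) f"
proof -
  have part: "unit_partition (\<A> n)" if "n \<ge> 1" for n
    using assms that unfolding martingale_difference_on_def partition_filtration_def by blast
  then have P: "countable (\<A> n)" "\<A> n \<subseteq> sets lebesgue" "disjoint (\<A> n)" "\<Union>(\<A> n) = {0..<1}"
    if "n \<ge> 1" for n
    using that unfolding unit_partition_def by blast+
  have Pow: "\<A> n \<subseteq> Pow {0..<1}" if "n \<ge> 1" for n using P(4)[OF that] by auto
  have refine: "\<exists>C\<subseteq>\<A> (n + 1). A = \<Union>C" if "n \<ge> 1" "A \<in> \<A> n" for n A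
    using assms that unfolding martingale_difference_on_def partition_filtration_def by blast
  have int: "integrable unit_leb (f n)" if "n \<ge> 1" for n
    using assms that unfolding martingale_difference_on_def by blast
  have sets_unit: "A \<in> sets unit_leb" if "A \<in> \<A> n" "n \<ge> 1" for A n
    using P[of n] Pow[of n] that by (auto simp: sets_restrict_space_iff)
  have zero: "(LINT x:A|unit_leb. f n x) = 0" if "n \<ge> 2" "A \<in> \<A> (n - 1)" for n A
  proof -
    have "n - 1 \<ge> 1" using that by simp
    then have "A \<subseteq> {0..<1}" using Pow that by blast
    have "(\<lambda>x. indicator {0..<1} x *\<^sub>R indicator A x *\<^sub>R f n x) = (\<lambda>x. indicator A x *\<^sub>R f n x)"
    proof (intro ext)
      show "indicator {0..<1} x *\<^sub>R indicator A x *\<^sub>R f n x = indicator A x *\<^sub>R f n x" for x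
        using \<open>A \<subseteq> {0..<1}\<close> by (cases "x \<in> A") auto
    qed
    then have "(LINT x:A|unit_leb. f n x) = (LINT x:A|lebesgue. f n x)"
      unfolding set_lebesgue_integral_def by (subst integral_restrict_space) simp_all
    then show ?thesis
      using assms that unfolding martingale_difference_on_def by simp
  qed
  have sets_mono: "sets (sigma {0..<1} (\<A> m)) \<subseteq> sets (sigma {0..<1} (\<A> n))" if "1 \<le> m" "m \<le> n" for m n
    using that(2)
  proof (induction n rule: dec_induct)
    case (step n)
    have n: "1 \<le> n" using step.hyps \<open>1 \<le> m\<close> by simp
    have "\<A> n \<subseteq> sigma_sets {0..<1} (\<A> (Suc n))"
    proof
      fix A assume "A \<in> \<A> n"
      then obtain C where C: "C \<subseteq> \<A> (Suc n)" "A = \<Union>C" using refine[OF n] by auto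
      have "\<Union>C \<in> sets (sigma {0..<1} (\<A> (Suc n)))"
        using C(1) P(1)[of "Suc n"] Pow[of "Suc n"]
        by (intro sets.countable_Union) (auto intro: countable_subset)
      then show "A \<in> sigma_sets {0..<1} (\<A> (Suc n))"
        using C(2) Pow[of "Suc n"] by (simp add: sets_measure_of)
    qed
    then have "sigma_sets {0..<1} (\<A> n) \<subseteq> sigma_sets {0..<1} (\<A> (Suc n))"
      by (rule sigma_sets_mono)
    then show ?case
      using step that Pow[of n] Pow[of "Suc n"] by (simp add: sets_measure_of)
  qed simp
  interpret finite_measure unit_leb
    by (rule finite_measureI) (simp add: space_unit_leb emeasure_restrict_space)
  show ?thesis
  proof unfold_locales
    fix n :: nat assume n: "1 \<le> n"
    have "sigma_sets {0..<1} (\<A> n) \<subseteq> sets unit_leb"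
      using sets.sigma_sets_subset[of "\<A> n" unit_leb] sets_unit n by (auto simp: space_unit_leb)
    then show "subalgebra unit_leb (sigma {0..<1} (\<A> n))"
      using Pow[OF n] by (simp add: subalgebra_def sets_measure_of space_measure_of space_unit_leb)
    show "f n \<in> borel_measurable (sigma {0..<1} (\<A> n))"
      using P[OF n] assms n unfolding martingale_difference_on_def
      by (intro borel_measurable_sigma_partition) auto
    show "integrable unit_leb (f n)" using int n .
  next
    fix m n :: nat assume mn: "1 \<le> m" "m \<le> n"
    then show "subalgebra (sigma {0..<1} (\<A> n)) (sigma {0..<1} (\<A> m))"
      using sets_mono[OF mn] Pow[of m] Pow[of n] mn by (simp add: subalgebra_def space_measure_of)
  next
    fix m n B assume mn: "(1::nat) \<le> m" "m < n" and B: "B \<in> sets (sigma {0..<1} (\<A> m))"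
    have n: "n - 1 \<ge> 1" "n \<ge> 2" "m \<le> n - 1" using mn by auto
    \<comment> \<open>Mean zero is given on the partition just before \<open>n\<close>; a set known
      at time \<open>m \<le> n - 1\<close> is a union of members of it.\<close>
    have "B \<in> sigma_sets {0..<1} (\<A> (n - 1))"
      using sets_mono[OF mn(1) n(3)] B Pow[OF n(1)] by (auto simp: sets_measure_of)
    then obtain C where C: "C \<subseteq> \<A> (n - 1)" "B = \<Union>C"
      using sigma_sets_partition[OF P(3,4)[OF n(1)]] by blast
    show "(LINT x:B|unit_leb. f n x) = 0"
      unfolding C(2)
    proof (rule set_integral_Union_eq_0)
      show "integrable unit_leb (f n)" using int n by simp
      show "countable C" using C P(1)[OF n(1)] countable_subset by blast
      show "disjoint C" using C P(3)[OF n(1)] by (meson pairwise_subset)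
      show "C \<subseteq> sets unit_leb" using C sets_unit n(1) by blast
    qed (use C zero n in auto)
  qed
qed

section \<open>Multipliers for systems of non-overlapping polynomials\<close>

theorem corollary1p1:
  fixes f p :: "nat \<Rightarrow> real \<Rightarrow> real" and G :: "nat \<Rightarrow> nat set" and c :: "nat \<Rightarrow> real"
  assumes "martingale_difference f"
    and "\<And>n. n \<ge> 1 \<Longrightarrow> finite (G n)"
    and "\<And>n. n \<ge> 1 \<Longrightarrow> G n \<subseteq> {1..}"
    and "disjoint_family_on G {1..}"
    and "\<And>n x. n \<ge> 1 \<Longrightarrow> x \<in> {0..<1} \<Longrightarrow> p n x = (\<Sum>j\<in>G n. c j * f j x)"
    and "\<And>n. n \<ge> 1 \<Longrightarrow> square_integrable (p n)"
    and "\<And>n. n \<ge> 1 \<Longrightarrow> L2_norm (p n) = 1"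
  shows "C_multiplier (\<lambda>n. log 2 (real n)) p"
proof -
  from assms(1) obtain \<A> where "martingale_difference_on \<A> f"
    unfolding martingale_difference_def by blast
  then interpret f: martingale_differences unit_leb "\<lambda>n. sigma {0..<1} (\<A> n)" f
    by (rule martingale_differences_sigma)
  interpret cf: martingale_differences unit_leb "\<lambda>n. sigma {0..<1} (\<A> n)" "\<lambda>n x. c n * f n x"
    by (rule f.scale)
  have p2: "(LINT x|unit_leb. (p n x)\<^sup>2) = 1" if "n \<ge> 1" for n
    using assms(7)[OF that] unfolding L2_norm_def by simp
  have p_int: "integrable unit_leb (\<lambda>x. (\<Sum>j\<in>G n. c j * f j x)\<^sup>2)" if "n \<ge> 1" for n
    using assms(6)[OF that] assms(5)[OF that] unfolding square_integrable_def
    by (subst Bochner_Integration.integrable_cong[OF refl, where g = "\<lambda>x. (p n x)\<^sup>2"])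
      (auto simp: space_unit_leb)
  \<comment> \<open>Square integrability is obtained for \<open>c j * f j\<close> and not for
    \<open>f j\<close>, which is merely integrable and may come with \<open>c j = 0\<close>; hence
    the scaled differences \<open>cf\<close>.\<close>
  have comp: "integrable unit_leb (\<lambda>x. (c j * f j x)\<^sup>2)" if "n \<ge> 1" "j \<in> G n" for n j
    using cf.integrable_square_component[OF assms(2,3)[OF that(1)] p_int[OF that(1)] that(2)] .
  have "orthonormal_system p"
    unfolding orthonormal_system_def
  proof (intro conjI allI impI)
    fix m n :: nat assume mn: "1 \<le> m" "1 \<le> n"
    show "(LINT x|unit_leb. p m x * p n x) = (if m = n then 1 else 0)"
    proof (cases "m = n")
      case True
      then show ?thesis using p2 mn by (simp flip: power2_eq_square)
    next
      case False
      then have "G m \<inter> G n = {}" using assms(4) mn by (auto simp: disjoint_family_on_def)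
      then have "(LINT x|unit_leb. (\<Sum>j\<in>G m. c j * f j x) * (\<Sum>k\<in>G n. c k * f k x)) = 0"
        using assms(2,3) mn comp by (intro cf.integral_mult_transforms) auto
      moreover have "(LINT x|unit_leb. p m x * p n x)
          = (LINT x|unit_leb. (\<Sum>j\<in>G m. c j * f j x) * (\<Sum>k\<in>G n. c k * f k x))"
        using assms(5) mn by (intro Bochner_Integration.integral_cong) (auto simp: space_unit_leb)
      ultimately show ?thesis using False by simp
    qed
  qed (use assms(6) in auto)
  moreover have "AE x in unit_leb. summable (\<lambda>n. a (Suc n) * p (Suc n) x)"
    if a: "summable (\<lambda>n. (a (Suc n))\<^sup>2 * log 2 (Suc n))" for a
  proof -
    \<comment> \<open>Each \<open>j\<close> lies in at most one \<open>G n\<close> with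
      \<open>n \<ge> 1\<close>, where \<open>e j\<close> is the coefficient of \<open>f j\<close> in
      \<open>a n * p n\<close>; for all other \<open>j\<close> the value is unspecified.\<close>
    define e where "e j = a (THE n. n \<ge> 1 \<and> j \<in> G n) * c j" for j
    have "(THE n. n \<ge> 1 \<and> j \<in> G n) = n" if "n \<ge> 1" "j \<in> G n" for j n
      using that assms(4) by (intro the_equality) (auto simp: disjoint_family_on_def)
    then have e: "e j = a n * c j" if "n \<ge> 1" "j \<in> G n" for j n
      using that by (simp add: e_def)
    interpret ef: martingale_differences unit_leb "\<lambda>n. sigma {0..<1} (\<A> n)" "\<lambda>n x. e n * f n x"
      by (rule f.scale)
    have sum_e: "(\<Sum>j\<in>G (Suc i). e j * f j x) = a (Suc i) * (\<Sum>j\<in>G (Suc i). c j * f j x)" for i x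
      unfolding sum_distrib_left by (intro sum.cong) (auto simp: e[of "Suc i"])
    have sq_e: "(LINT x|unit_leb. (\<Sum>j\<in>G (Suc i). e j * f j x)\<^sup>2) = (a (Suc i))\<^sup>2" for i
    proof -
      have "(LINT x|unit_leb. (\<Sum>j\<in>G (Suc i). c j * f j x)\<^sup>2) = (LINT x|unit_leb. (p (Suc i) x)\<^sup>2)"
        using assms(5) by (intro Bochner_Integration.integral_cong) (auto simp: space_unit_leb)
      then show ?thesis using p2[of "Suc i"] by (simp add: sum_e power_mult_distrib)
    qed
    have "AE x in unit_leb. summable (\<lambda>i. \<Sum>j\<in>G (Suc i). e j * f j x)"
    proof (rule ef.AE_summable_disjoint_blocks)
      show "disjoint_family (\<lambda>i. G (Suc i))" using assms(4) by (simp add: disjoint_family_on_def)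
      show "integrable unit_leb (\<lambda>x. (\<Sum>j\<in>G (Suc i). e j * f j x)\<^sup>2)" for i
        using p_int[of "Suc i"] by (simp add: sum_e power_mult_distrib)
      show "summable (\<lambda>i. (LINT x|unit_leb. (\<Sum>j\<in>G (Suc i). e j * f j x)\<^sup>2) * log 2 (Suc i))"
        unfolding sq_e by (rule a)
    qed (use assms(2,3) in auto)
    \<comment> \<open>\<open>p\<close> is given by its polynomial on \<open>{0..<1}\<close> only,
      hence \<open>AE_space\<close>.\<close>
    then show ?thesis
      using AE_space by eventually_elim (simp add: sum_e assms(5) space_unit_leb)
  qed
  moreover have "mono_on {1..} (\<lambda>n. log 2 (real n))"
    by (intro mono_onI) simp
  moreover have "filterlim (\<lambda>n. log 2 (real n)) at_top sequentially"
    unfolding log_def divide_inverse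
    by (intro filterlim_at_top_mult_tendsto_pos[OF tendsto_const]
        filterlim_compose[OF ln_at_top filterlim_real_sequentially]) simp
  ultimately show ?thesis unfolding C_multiplier_def by blast
qed

end
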